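(* If $t$ is a positive integer and $G$ is a graph of size $m$ (that is, with $m$ edges), then $$\chi_{t}^{f}(G)\geq \dfrac{1}{2}+\sqrt{\dfrac{1}{4}+\dfrac{2m}{t\,\alpha_{t}^{f}(G)}}$$ with equality if and only if $G\in \Psi_{t}$.
   Context: All graphs are finite and simple. For a positive integer $t$, a set $S\subseteq V(G)$ is a $t$-frugal independent set of $G$ if $S$ is independent and every vertex of $G$ has at most $t$ neighbors in $S$; $\alpha_t^f(G)$ is the maximum cardinality of a $t$-frugal independent set in $G$. A $t$-frugal coloring of $G$ is a proper vertex coloring in which no color appears more than $t$ times in the (open) neighborhood of any vertex, equivalently a partition of $V(G)$ into $t$-frugal independent sets; $\chi_t^f(G)$ is the minimum number of colors in a $t$-frugal coloring of $G$. The family $\Psi_t$ consists of all graphs $G$ that are $r$-partite for some $r\ge 2$, such that for each partite set $X$ and each $v\in X$, the vertex $v$ has precisely $t$ neighbors in every other partite set.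
   Formalization: G is taken nonempty, and the equality characterization is stated only for m > 0: for an edgeless nonempty G (e.g. one vertex) both sides equal 1, yet G is not in Ψ_t, so the claim fails there; the inequality is kept for m = 0. *)

theory Defs
  imports Complex_Main "HOL-Library.Disjoint_Sets" "HOL-Library.FuncSet"
begin

locale simple_graph =
  fixes V :: "'a set" and E :: "'a set set"
  assumes finite_vertices: "finite V"
    and edges: "e \<in> E \<Longrightarrow> e \<subseteq> V \<and> card e = 2"

definition neighborhood :: "'a set \<Rightarrow> 'a set set \<Rightarrow> 'a \<Rightarrow> 'a set" where
  "neighborhood V E v = {u \<in> V. {u, v} \<in> E}"

definition independent_set :: "'a set \<Rightarrow> 'a set set \<Rightarrow> 'a set \<Rightarrow> bool" where
  "independent_set V E S \<longleftrightarrow> S \<subseteq> V \<and> (\<forall>u\<in>S. \<forall>v\<in>S. {u, v} \<notin> E)"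

definition frugal_independent_set :: "nat \<Rightarrow> 'a set \<Rightarrow> 'a set set \<Rightarrow> 'a set \<Rightarrow> bool" where
  "frugal_independent_set t V E S \<longleftrightarrow>
     independent_set V E S \<and> (\<forall>v\<in>V. card (neighborhood V E v \<inter> S) \<le> t)"

definition frugal_independence_number :: "nat \<Rightarrow> 'a set \<Rightarrow> 'a set set \<Rightarrow> nat" where
  "frugal_independence_number t V E = Max {card S | S. frugal_independent_set t V E S}"

definition frugal_coloring :: "nat \<Rightarrow> 'a set \<Rightarrow> 'a set set \<Rightarrow> ('a \<Rightarrow> nat) \<Rightarrow> bool" where
  "frugal_coloring t V E c \<longleftrightarrow>
     (\<forall>u\<in>V. \<forall>v\<in>V. {u, v} \<in> E \<longrightarrow> c u \<noteq> c v) \<and>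
     (\<forall>v\<in>V. \<forall>i. card {u \<in> neighborhood V E v. c u = i} \<le> t)"

text \<open>For a finite graph and \<open>t \<ge> 1\<close> the minimum below exists, since any injective colouring
  is \<open>t\<close>-frugal.\<close>

definition frugal_chromatic_number :: "nat \<Rightarrow> 'a set \<Rightarrow> 'a set set \<Rightarrow> nat" where
  "frugal_chromatic_number t V E =
     (LEAST k. \<exists>c \<in> V \<rightarrow> {..<k}. frugal_coloring t V E c)"

text \<open>The parts of a \<^const>\<open>partition_on\<close> are nonempty. For \<open>V \<noteq> {}\<close> and \<open>t \<ge> 1\<close>
  this is no restriction: a vertex has \<open>t\<close> neighbours in each part other than its own.\<close>

definition Psi :: "nat \<Rightarrow> ('a set \<times> 'a set set) set" where
  "Psi t = {(V, E). simple_graph V E \<and>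
     (\<exists>r\<ge>2. \<exists>P. partition_on V P \<and> card P = r \<and> (\<forall>X\<in>P. independent_set V E X) \<and>
        (\<forall>X\<in>P. \<forall>v\<in>X. \<forall>Y\<in>P. Y \<noteq> X \<longrightarrow> card (neighborhood V E v \<inter> Y) = t))}"

end

theory Submission
  imports Defs
begin

text \<open>
  The bound comes from counting degrees. Write \<open>n\<close>, \<open>m\<close> for the order and the size of the graph,
  \<open>k\<close> for its \<open>t\<close>-frugal chromatic number and \<open>a\<close> for its \<open>t\<close>-frugal independence number. In a
  \<open>t\<close>-frugal colouring with \<open>k\<close> colours a vertex has no neighbour of its own colour and at most
  \<open>t\<close> of each other colour, so its degree is at most \<open>t (k - 1)\<close>; each colour class is a
  \<open>t\<close>-frugal independent set, so \<open>n \<le> k a\<close>. The handshake lemma yields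
  \<open>2 m \<le> n t (k - 1) \<le> t a k (k - 1)\<close>, and solving this quadratic
  inequality for \<open>k\<close> gives the stated form (lemmas \<open>twice_size_le\<close>, \<open>order_le\<close>, \<open>half_plus_sqrt_le_iff\<close>).

  If equality holds, every vertex has exactly \<open>t\<close> neighbours of every colour but its own, and
  \<open>m > 0\<close> forces \<open>k \<ge> 2\<close>. Such colourings are called tight below. For \<open>t \<ge> 1\<close> the nonempty graphs
  that have one with at least two colours are exactly the nonempty members of \<open>\<Psi>\<^sub>t\<close> (lemma \<open>Psi_iff_tight_coloring\<close>).

  Conversely, let a tight colouring use \<open>r \<ge> 2\<close> colours. The graph is then regular of degree
  \<open>t (r - 1)\<close>. A \<open>t\<close>-frugal independent set \<open>S\<close> sends \<open>|S| t (r - 1)\<close> edges to its complement,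
  which can absorb at most \<open>t (n - |S|)\<close> of them, so \<open>r |S| \<le> n\<close>
  (lemma \<open>tight_coloring_frugal_set_le\<close>). Hence \<open>n = r a\<close> and \<open>2 m = t a r (r - 1)\<close>. The
  inequality already proved now reads \<open>r (r - 1) \<le> k (k - 1)\<close>, and \<open>k \<le> r\<close> by minimality, so
  \<open>k = r\<close> and equality holds.
\<close>

section \<open>Counting edges\<close>

lemma (in simple_graph) finite_neighborhood: "finite (neighborhood V E v)"
  using finite_vertices by (auto simp: neighborhood_def)

lemma (in simple_graph) card_neighborhood:
  assumes "v \<in> V"
  shows "card (neighborhood V E v) = card {e \<in> E. v \<in> e}"
proof (rule bij_betw_same_card[where f = "\<lambda>u. {u, v}"])
  have "\<exists>u \<in> V. e = {u, v}" if "e \<in> E" and "v \<in> e" for e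
  proof -
    obtain x y where "e = {x, y}"
      using edges[OF \<open>e \<in> E\<close>] by (auto simp: card_2_iff)
    then show ?thesis
      using edges[OF \<open>e \<in> E\<close>] \<open>v \<in> e\<close> by auto
  qed
  then show "bij_betw (\<lambda>u. {u, v}) (neighborhood V E v) {e \<in> E. v \<in> e}"
    by (auto simp: bij_betw_def inj_on_def neighborhood_def doubleton_eq_iff)
qed

lemma (in simple_graph) handshake:
  "(\<Sum>v\<in>V. card (neighborhood V E v)) = 2 * card E"
proof -
  have "E \<subseteq> Pow V"
    using edges by blast
  then have "finite E"
    using finite_vertices by (meson finite_Pow_iff finite_subset)
  have "card {v \<in> V. v \<in> e} = 2" if "e \<in> E" for e
  proof -
    have "{v \<in> V. v \<in> e} = e"
      using edges[OF that] by blast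
    then show ?thesis
      using edges[OF that] by simp
  qed
  then have "(\<Sum>v\<in>V. card {e \<in> E. v \<in> e}) = 2 * card E"
    by (intro sum_multicount[OF finite_vertices \<open>finite E\<close>]) simp
  then show ?thesis
    by (simp add: card_neighborhood)
qed

text \<open>Both sides count the pairs formed by a vertex of \<open>S\<close> and one of its neighbours.\<close>

lemma (in simple_graph) sum_degree_eq_sum_neighbors_inside:
  assumes "S \<subseteq> V"
  shows "(\<Sum>v\<in>S. card (neighborhood V E v)) = (\<Sum>u\<in>V. card (neighborhood V E u \<inter> S))"
proof -
  have fin: "finite S"
    using assms finite_vertices finite_subset by blast
  have "(\<Sum>u\<in>V. card {v \<in> S. v \<in> neighborhood V E u})
      = (\<Sum>v\<in>S. card {u \<in> V. v \<in> neighborhood V E u})"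
    by (rule sum_multicount_gen[OF finite_vertices fin]) simp
  also have "\<dots> = (\<Sum>v\<in>S. card (neighborhood V E v))"
  proof (rule sum.cong[OF refl])
    fix v
    assume "v \<in> S"
    then have "{u \<in> V. v \<in> neighborhood V E u} = neighborhood V E v"
      using assms by (auto simp: neighborhood_def insert_commute)
    then show "card {u \<in> V. v \<in> neighborhood V E u} = card (neighborhood V E v)"
      by simp
  qed
  finally show ?thesis
    by (simp add: Int_def conj_commute)
qed

section \<open>Frugal independent sets and frugal colourings\<close>

lemma (in simple_graph) finite_frugal_set_cards:
  "finite {card S | S. frugal_independent_set t V E S}"
proof (rule finite_subset)
  show "{card S | S. frugal_independent_set t V E S} \<subseteq> card ` Pow V"
    by (auto simp: frugal_independent_set_def independent_set_def)
  show "finite (card ` Pow V)"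
    using finite_vertices by simp
qed

lemma (in simple_graph) card_le_frugal_independence_number:
  "frugal_independent_set t V E S \<Longrightarrow> card S \<le> frugal_independence_number t V E"
  unfolding frugal_independence_number_def
  by (rule Max_ge[OF finite_frugal_set_cards]) blast

lemma (in simple_graph) frugal_independence_number_attained:
  obtains S where "frugal_independent_set t V E S"
    and "card S = frugal_independence_number t V E"
proof -
  have "frugal_independent_set t V E {}"
    by (simp add: frugal_independent_set_def independent_set_def)
  then have "{card S | S. frugal_independent_set t V E S} \<noteq> {}"
    by blast
  from Max_in[OF finite_frugal_set_cards this] show thesis
    using that unfolding frugal_independence_number_def by force
qed

lemma (in simple_graph) frugal_independence_number_pos:
  assumes "V \<noteq> {}" and "t \<ge> 1"
  shows "frugal_independence_number t V E > 0"
proof -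
  obtain v where "v \<in> V"
    using assms by blast
  have "{v} \<notin> E"
    using edges[of "{v}"] by auto
  moreover have "card (neighborhood V E u \<inter> {v}) \<le> t" for u
    using assms(2) card_mono[of "{v}" "neighborhood V E u \<inter> {v}"] by simp
  ultimately have "frugal_independent_set t V E {v}"
    using \<open>v \<in> V\<close> by (simp add: frugal_independent_set_def independent_set_def)
  from card_le_frugal_independence_number[OF this] show ?thesis
    by simp
qed

lemma frugal_coloring_class:
  assumes "frugal_coloring t V E c"
  shows "frugal_independent_set t V E {u \<in> V. c u = i}"
proof -
  have "neighborhood V E v \<inter> {u \<in> V. c u = i} = {u \<in> neighborhood V E v. c u = i}" for v
    by (auto simp: neighborhood_def)
  then show ?thesis
    using assms
    by (auto simp: frugal_coloring_def frugal_independent_set_def independent_set_def) metis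
qed

lemma (in simple_graph) frugal_chromatic_number_attained:
  assumes "t \<ge> 1"
  obtains c where "c \<in> V \<rightarrow> {..<frugal_chromatic_number t V E}" and "frugal_coloring t V E c"
proof -
  obtain h where h: "bij_betw h V {0..<card V}"
    using ex_bij_betw_finite_nat[OF finite_vertices] by blast
  have "frugal_coloring t V E h"
    unfolding frugal_coloring_def
  proof (intro conjI ballI impI allI)
    fix u v
    assume "u \<in> V" "v \<in> V" "{u, v} \<in> E"
    moreover from this have "u \<noteq> v"
      using edges[of "{u, v}"] by auto
    ultimately show "h u \<noteq> h v"
      using h by (auto simp: bij_betw_def inj_on_def)
  next
    fix v i
    have "x = y" if "x \<in> V" "y \<in> V" "h x = i" "h y = i" for x y
      using that h by (auto simp: bij_betw_def inj_on_def)
    then have "card {u \<in> neighborhood V E v. h u = i} \<le> 1"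
      using finite_vertices
      by (subst card_le_Suc0_iff_eq[folded One_nat_def]) (auto simp: neighborhood_def)
    then show "card {u \<in> neighborhood V E v. h u = i} \<le> t"
      using assms by simp
  qed
  moreover have "h \<in> V \<rightarrow> {..<card V}"
    using h by (auto simp: bij_betw_def)
  ultimately have "\<exists>k. \<exists>c \<in> V \<rightarrow> {..<k}. frugal_coloring t V E c"
    by blast
  from LeastI_ex[OF this] show thesis
    using that unfolding frugal_chromatic_number_def by blast
qed

lemma frugal_chromatic_number_le:
  assumes "c \<in> V \<rightarrow> {..<k}" and "frugal_coloring t V E c"
  shows "frugal_chromatic_number t V E \<le> k"
  unfolding frugal_chromatic_number_def using assms by (intro Least_le) blast

text \<open>The colour classes cover the vertices, and each has at most as many elements as the largest
  \<open>t\<close>-frugal independent set.\<close>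

lemma (in simple_graph) order_le:
  assumes "c \<in> V \<rightarrow> {..<k}" and "frugal_coloring t V E c"
  shows "card V \<le> k * frugal_independence_number t V E"
proof -
  have "V = (\<Union>i\<in>{..<k}. {u \<in> V. c u = i})"
    using assms(1) by auto
  then have "card V \<le> (\<Sum>i<k. card {u \<in> V. c u = i})"
    using card_UN_le[of "{..<k}" "\<lambda>i. {u \<in> V. c u = i}"] by simp
  also have "\<dots> \<le> (\<Sum>i<k. frugal_independence_number t V E)"
    by (intro sum_mono card_le_frugal_independence_number frugal_coloring_class assms(2))
  finally show ?thesis
    by simp
qed

section \<open>Tight colourings\<close>

definition tight_coloring :: "nat \<Rightarrow> 'a set \<Rightarrow> 'a set set \<Rightarrow> nat \<Rightarrow> ('a \<Rightarrow> nat) \<Rightarrow> bool" where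
  "tight_coloring t V E k c \<longleftrightarrow>
     c \<in> V \<rightarrow> {..<k} \<and> frugal_coloring t V E c \<and>
     (\<forall>v\<in>V. \<forall>i\<in>{..<k} - {c v}. card {u \<in> neighborhood V E v. c u = i} = t)"

lemma (in simple_graph) degree_by_colors:
  assumes "c \<in> V \<rightarrow> {..<k}" and "frugal_coloring t V E c" and "v \<in> V"
  shows "card (neighborhood V E v)
    = (\<Sum>i\<in>{..<k} - {c v}. card {u \<in> neighborhood V E v. c u = i})"
proof -
  have "neighborhood V E v = (\<Union>i\<in>{..<k} - {c v}. {u \<in> neighborhood V E v. c u = i})"
    using assms by (auto simp: neighborhood_def frugal_coloring_def)
  also have "card \<dots> = (\<Sum>i\<in>{..<k} - {c v}. card {u \<in> neighborhood V E v. c u = i})"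
    using finite_neighborhood by (intro card_UN_disjoint) auto
  finally show ?thesis .
qed

lemma (in simple_graph) sum_max_degrees:
  assumes "c \<in> V \<rightarrow> {..<k}"
  shows "(\<Sum>v\<in>V. \<Sum>i\<in>{..<k} - {c v}. t) = card V * (t * (k - 1))"
proof -
  have "(\<Sum>i\<in>{..<k} - {c v}. t) = t * (k - 1)" if "v \<in> V" for v
    using assms that by (auto simp: Pi_iff)
  then show ?thesis
    by (subst sum.cong[OF refl, where h = "\<lambda>_. t * (k - 1)"]) simp_all
qed

lemma (in simple_graph) twice_size_by_colors:
  assumes "c \<in> V \<rightarrow> {..<k}" and "frugal_coloring t V E c"
  shows "2 * card E
    = (\<Sum>v\<in>V. \<Sum>i\<in>{..<k} - {c v}. card {u \<in> neighborhood V E v. c u = i})"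
  using degree_by_colors[OF assms] by (simp flip: handshake)

lemma (in simple_graph) twice_size_le:
  assumes "c \<in> V \<rightarrow> {..<k}" and "frugal_coloring t V E c"
  shows "2 * card E \<le> card V * (t * (k - 1))"
  unfolding twice_size_by_colors[OF assms] sum_max_degrees[OF assms(1), symmetric]
  using assms(2) by (intro sum_mono) (auto simp: frugal_coloring_def)

text \<open>The size and its upper bound are double sums that compare term by term, so they agree only
  if all their terms do.\<close>

lemma (in simple_graph) tight_coloring_iff_twice_size:
  assumes "c \<in> V \<rightarrow> {..<k}" and "frugal_coloring t V E c"
  shows "tight_coloring t V E k c \<longleftrightarrow> 2 * card E = card V * (t * (k - 1))"
proof
  assume "tight_coloring t V E k c"
  then show "2 * card E = card V * (t * (k - 1))"
    unfolding twice_size_by_colors[OF assms] sum_max_degrees[OF assms(1), symmetric]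
    by (intro sum.cong) (auto simp: tight_coloring_def)
next
  let ?N = "\<lambda>v i. card {u \<in> neighborhood V E v. c u = i}"
  assume "2 * card E = card V * (t * (k - 1))"
  then have eq: "(\<Sum>v\<in>V. \<Sum>i\<in>{..<k} - {c v}. ?N v i) = (\<Sum>v\<in>V. \<Sum>i\<in>{..<k} - {c v}. t)"
    by (simp only: twice_size_by_colors[OF assms] sum_max_degrees[OF assms(1)])
  have le: "?N v i \<le> t" if "v \<in> V" for v i
    using assms(2) that by (simp add: frugal_coloring_def)
  have "?N v i = t" if v: "v \<in> V" and i: "i \<in> {..<k} - {c v}" for v i
  proof (rule sum_mono_inv[where f = "?N v" and g = "\<lambda>_. t"])
    show "(\<Sum>i\<in>{..<k} - {c v}. ?N v i) = (\<Sum>i\<in>{..<k} - {c v}. t)"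
      by (rule sum_mono_inv[OF eq _ v finite_vertices]) (intro sum_mono le)
  qed (use le v i in auto)
  then show "tight_coloring t V E k c"
    using assms by (simp add: tight_coloring_def)
qed

text \<open>Edges leaving \<open>S\<close> are counted from both ends: all neighbours of a vertex of \<open>S\<close> lie outside
  \<open>S\<close> by independence, and a vertex outside \<open>S\<close> has at most \<open>t\<close> neighbours in \<open>S\<close> by frugality.\<close>

lemma (in simple_graph) tight_coloring_frugal_set_le:
  assumes c: "tight_coloring t V E k c" and S: "frugal_independent_set t V E S"
    and "t \<ge> 1" and "k \<ge> 1"
  shows "k * card S \<le> card V"
proof -
  have SV: "S \<subseteq> V"
    using S by (simp add: frugal_independent_set_def independent_set_def)
  have deg: "card (neighborhood V E v) = t * (k - 1)" if "v \<in> V" for v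
  proof -
    have "card (neighborhood V E v) = (\<Sum>i\<in>{..<k} - {c v}. t)"
      using c that by (subst degree_by_colors[where k = k and c = c and t = t])
        (auto simp: tight_coloring_def intro!: sum.cong)
    then show ?thesis
      using c that by (auto simp: tight_coloring_def Pi_iff)
  qed
  have inside: "neighborhood V E u \<inter> S = {}" if "u \<in> S" for u
    using S that by (auto simp: frugal_independent_set_def independent_set_def neighborhood_def)
  have "card S * (t * (k - 1)) = (\<Sum>v\<in>S. card (neighborhood V E v))"
    using deg SV by (simp add: subset_iff)
  also have "\<dots> = (\<Sum>u\<in>V. card (neighborhood V E u \<inter> S))"
    by (rule sum_degree_eq_sum_neighbors_inside[OF SV])
  also have "\<dots> = (\<Sum>u\<in>V - S. card (neighborhood V E u \<inter> S))"
    using inside finite_vertices by (intro sum.mono_neutral_right) auto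
  also have "\<dots> \<le> (\<Sum>u\<in>V - S. t)"
    using S by (intro sum_mono) (auto simp: frugal_independent_set_def)
  also have "\<dots> = t * (card V - card S)"
    using SV finite_vertices by (simp add: card_Diff_subset finite_subset)
  finally have "t * (card S * (k - 1)) \<le> t * (card V - card S)"
    by (simp add: ac_simps)
  then have "card S * (k - 1) \<le> card V - card S"
    using \<open>t \<ge> 1\<close> by simp
  moreover have "card S \<le> card V"
    using SV finite_vertices by (rule card_mono[rotated])
  moreover have "k * card S = card S * (k - 1) + card S"
    using \<open>k \<ge> 1\<close> by (simp add: algebra_simps)
  ultimately show ?thesis
    by simp
qed

lemma (in simple_graph) tight_coloring_order:
  assumes c: "tight_coloring t V E k c" and "t \<ge> 1" and "k \<ge> 1"
  shows "card V = k * frugal_independence_number t V E"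
proof (rule antisym)
  show "card V \<le> k * frugal_independence_number t V E"
    using c by (intro order_le) (auto simp: tight_coloring_def)
  show "k * frugal_independence_number t V E \<le> card V"
    using frugal_independence_number_attained tight_coloring_frugal_set_le[OF c _ assms(2,3)]
    by metis
qed

section \<open>Tight colourings and the family \<open>\<Psi>\<^sub>t\<close>\<close>

text \<open>Numbering the parts of a partition that witnesses membership in \<open>\<Psi>\<^sub>t\<close> gives a tight
  colouring.\<close>

lemma (in simple_graph) tight_coloring_of_Psi:
  assumes "(V, E) \<in> Psi t"
  obtains k c where "k \<ge> 2" and "tight_coloring t V E k c"
proof -
  obtain P where P: "partition_on V P" "card P \<ge> 2" "\<And>X. X \<in> P \<Longrightarrow> independent_set V E X"
    "\<And>X v Y. X \<in> P \<Longrightarrow> v \<in> X \<Longrightarrow> Y \<in> P \<Longrightarrow> Y \<noteq> X \<Longrightarrow> card (neighborhood V E v \<inter> Y) = t"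
    using assms by (auto simp: Psi_def)
  have "finite P"
    using P(2) card.infinite by force
  obtain h where h: "bij_betw h P {0..<card P}"
    using ex_bij_betw_finite_nat[OF \<open>finite P\<close>] by blast
  have "\<exists>X. X \<in> P \<and> v \<in> X" if "v \<in> V" for v
    using P(1) that by (auto simp: partition_on_def)
  then obtain part where part: "\<And>v. v \<in> V \<Longrightarrow> part v \<in> P \<and> v \<in> part v"
    by metis
  have part_unique: "part v = X" if "v \<in> X" and "X \<in> P" for v X
    using P(1) part[of v] that unfolding partition_on_def disjoint_def by blast
  define c where "c v = h (part v)" for v
  have color: "{u \<in> neighborhood V E v. c u = h X} = neighborhood V E v \<inter> X"
    if "X \<in> P" for v X
  proof -
    have "c u = h X \<longleftrightarrow> u \<in> X" if "u \<in> V" for u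
      using part[OF that] part_unique[of u X] \<open>X \<in> P\<close> h
      by (auto simp: c_def bij_betw_def inj_on_def)
    then show ?thesis
      by (auto simp: neighborhood_def)
  qed
  have range: "c \<in> V \<rightarrow> {..<card P}"
    using part h by (auto simp: c_def bij_betw_def)
  have proper: "c u \<noteq> c v" if "u \<in> V" "v \<in> V" "{u, v} \<in> E" for u v
  proof
    assume "c u = c v"
    then have "part u = part v"
      using part that h by (auto simp: c_def bij_betw_def inj_on_def)
    then show False
      using part[OF that(1)] part[OF that(2)] P(3)[of "part v"] that(3)
      by (auto simp: independent_set_def)
  qed
  have own: "card {u \<in> neighborhood V E v. c u = c v} = 0" if "v \<in> V" for v
  proof -
    have "{u \<in> neighborhood V E v. c u = c v} = {}"
      using proper that by (auto simp: neighborhood_def)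
    then show ?thesis
      by (simp only: card.empty)
  qed
  have other: "card {u \<in> neighborhood V E v. c u = i} = t"
    if "v \<in> V" "i < card P" "i \<noteq> c v" for v i
  proof -
    obtain Y where "Y \<in> P" "i = h Y"
      using h \<open>i < card P\<close> by (metis atLeast0LessThan bij_betw_def image_iff lessThan_iff)
    then show ?thesis
      using color P(4)[of "part v" v Y] part \<open>v \<in> V\<close> \<open>i \<noteq> c v\<close> by (auto simp: c_def)
  qed
  have unused: "card {u \<in> neighborhood V E v. c u = i} = 0" if "\<not> i < card P" for v i
  proof -
    have "{u \<in> neighborhood V E v. c u = i} = {}"
      using range that by (auto simp: neighborhood_def)
    then show ?thesis
      by (simp only: card.empty)
  qed
  have "card {u \<in> neighborhood V E v. c u = i} \<le> t" if "v \<in> V" for v i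
    using own[OF that] other[OF that, of i] unused[of i v]
    by (metis le_refl zero_le)
  then have "tight_coloring t V E (card P) c"
    using range proper other by (auto simp: tight_coloring_def frugal_coloring_def)
  then show thesis
    using that P(2) by blast
qed

text \<open>Conversely the colour classes form the partition. None of them is empty: some vertex exists,
  it lies in its own class, and it has \<open>t \<ge> 1\<close> neighbours in every other one. Hence distinct
  colours have distinct classes, so that the number of parts is the number of colours.\<close>

lemma (in simple_graph) Psi_of_tight_coloring:
  assumes "V \<noteq> {}" and "t \<ge> 1" and "k \<ge> 2" and c: "tight_coloring t V E k c"
  shows "(V, E) \<in> Psi t"
proof -
  define A where "A i = {u \<in> V. c u = i}" for i
  obtain w where "w \<in> V"
    using assms by blast
  have nonempty: "A i \<noteq> {}" if "i < k" for i
  proof (cases "i = c w")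
    case True
    then show ?thesis
      using \<open>w \<in> V\<close> by (auto simp: A_def)
  next
    case False
    then have "card {u \<in> neighborhood V E w. c u = i} = t"
      using c that \<open>w \<in> V\<close> by (auto simp: tight_coloring_def)
    then have "{u \<in> neighborhood V E w. c u = i} \<noteq> {}"
      using \<open>t \<ge> 1\<close> by (metis card.empty not_one_le_zero)
    then show ?thesis
      by (auto simp: A_def neighborhood_def)
  qed
  have neighbors: "neighborhood V E v \<inter> A i = {u \<in> neighborhood V E v. c u = i}" for v i
    by (auto simp: A_def neighborhood_def)
  have "inj_on A {..<k}"
  proof (rule inj_onI)
    fix i j
    assume "i \<in> {..<k}" and "A i = A j"
    then obtain u where "u \<in> A i" "u \<in> A j"
      using nonempty by blast
    then show "i = j"
      by (auto simp: A_def)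
  qed
  then have "card (A ` {..<k}) = k"
    by (simp add: card_image)
  moreover have "partition_on V (A ` {..<k})"
    unfolding partition_on_def
  proof (intro conjI)
    show "\<Union> (A ` {..<k}) = V"
      using c by (auto simp: A_def tight_coloring_def)
    show "disjoint (A ` {..<k})"
      by (auto simp: disjoint_def A_def)
    show "{} \<notin> A ` {..<k}"
      using nonempty by blast
  qed
  moreover have "independent_set V E X" if "X \<in> A ` {..<k}" for X
    using c frugal_coloring_class[of t V E c] that
    by (auto simp: A_def tight_coloring_def frugal_independent_set_def)
  moreover have "card (neighborhood V E v \<inter> Y) = t"
    if "X \<in> A ` {..<k}" "v \<in> X" "Y \<in> A ` {..<k}" "Y \<noteq> X" for X v Y
  proof -
    obtain j where "j < k" "Y = A j"
      using \<open>Y \<in> A ` {..<k}\<close> by blast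
    moreover have "v \<in> V" "X = A (c v)"
      using that by (auto simp: A_def)
    ultimately show ?thesis
      using c \<open>Y \<noteq> X\<close> by (auto simp: neighbors tight_coloring_def)
  qed
  ultimately show ?thesis
    using \<open>k \<ge> 2\<close> simple_graph_axioms unfolding Psi_def mem_Collect_eq case_prod_conv
    by (intro conjI exI[of _ k] exI[of _ "A ` {..<k}"]) blast+
qed

lemma (in simple_graph) Psi_iff_tight_coloring:
  assumes "V \<noteq> {}" and "t \<ge> 1"
  shows "(V, E) \<in> Psi t \<longleftrightarrow> (\<exists>k\<ge>2. \<exists>c. tight_coloring t V E k c)"
  using tight_coloring_of_Psi Psi_of_tight_coloring[OF assms] by metis

section \<open>The bound and its equality case\<close>

lemma (in simple_graph) frugal_chromatic_number_pos:
  assumes "V \<noteq> {}" and "t \<ge> 1"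
  shows "frugal_chromatic_number t V E \<ge> 1"
proof -
  obtain c where "c \<in> V \<rightarrow> {..<frugal_chromatic_number t V E}"
    using frugal_chromatic_number_attained[OF assms(2)] by blast
  then show ?thesis
    using assms(1) by fastforce
qed

lemma (in simple_graph) twice_size_le_frugal_numbers:
  fixes t :: nat
  defines "k \<equiv> frugal_chromatic_number t V E" and "a \<equiv> frugal_independence_number t V E"
  assumes "t \<ge> 1"
  shows "2 * card E \<le> t * a * (k * (k - 1))"
proof -
  obtain c where c: "c \<in> V \<rightarrow> {..<k}" "frugal_coloring t V E c"
    using frugal_chromatic_number_attained[OF assms(3)] unfolding k_def by blast
  have "2 * card E \<le> card V * (t * (k - 1))"
    by (rule twice_size_le[OF c])
  also have "\<dots> \<le> (k * a) * (t * (k - 1))"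
    using order_le[OF c] unfolding a_def by (rule mult_right_mono) simp
  finally show ?thesis
    by (simp add: ac_simps)
qed

lemma (in simple_graph) twice_size_eq_iff_Psi:
  fixes t :: nat
  defines "k \<equiv> frugal_chromatic_number t V E" and "a \<equiv> frugal_independence_number t V E"
  assumes "V \<noteq> {}" and "t \<ge> 1" and "card E > 0"
  shows "2 * card E = t * a * (k * (k - 1)) \<longleftrightarrow> (V, E) \<in> Psi t"
proof
  assume eq: "2 * card E = t * a * (k * (k - 1))"
  obtain c where c: "c \<in> V \<rightarrow> {..<k}" "frugal_coloring t V E c"
    using frugal_chromatic_number_attained[OF assms(4)] unfolding k_def by blast
  have "card V * (t * (k - 1)) \<le> (k * a) * (t * (k - 1))"
    using order_le[OF c] unfolding a_def by (rule mult_right_mono) simp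
  also have "\<dots> = 2 * card E"
    using eq by (simp add: ac_simps)
  finally have "2 * card E = card V * (t * (k - 1))"
    using twice_size_le[OF c] by (rule antisym[rotated])
  then have "tight_coloring t V E k c"
    using tight_coloring_iff_twice_size[OF c] by blast
  moreover have "k \<ge> 2"
  proof (rule ccontr)
    assume "\<not> k \<ge> 2"
    then have "k * (k - 1) = 0"
      by simp
    then show False
      using eq assms(5) by (simp only:)
  qed
  ultimately show "(V, E) \<in> Psi t"
    using Psi_iff_tight_coloring[OF assms(3,4)] by blast
next
  assume "(V, E) \<in> Psi t"
  \<comment> \<open>The number \<open>r\<close> of colours of the tight colouring is only known to be at least \<open>k\<close>. The bound
    for \<open>k\<close>, compared with the exact count for \<open>r\<close>, excludes \<open>k < r\<close>.\<close>
  then obtain r c where r: "r \<ge> 2" and c: "tight_coloring t V E r c"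
    using Psi_iff_tight_coloring[OF assms(3,4)] by blast
  then have c': "c \<in> V \<rightarrow> {..<r}" "frugal_coloring t V E c"
    by (simp_all add: tight_coloring_def)
  have "2 * card E = card V * (t * (r - 1))"
    using tight_coloring_iff_twice_size[OF c'] c by blast
  also have "card V = r * a"
    using tight_coloring_order[OF c assms(4)] r unfolding a_def by simp
  finally have size: "2 * card E = t * a * (r * (r - 1))"
    by (simp add: ac_simps)
  have "t * a > 0"
    using frugal_independence_number_pos[OF assms(3,4)] assms(4) unfolding a_def by simp
  moreover have "t * a * (r * (r - 1)) \<le> t * a * (k * (k - 1))"
    using twice_size_le_frugal_numbers[OF assms(4)] size unfolding a_def k_def by simp
  ultimately have "r * (r - 1) \<le> k * (k - 1)"
    by simp
  moreover have "k \<le> r"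
    unfolding k_def by (rule frugal_chromatic_number_le[OF c'])
  moreover have "k * (k - 1) < r * (r - 1)" if "k < r"
  proof -
    have "k * (k - 1) \<le> k * (r - 1)"
      using that by (intro mult_left_mono) auto
    also have "\<dots> < r * (r - 1)"
      using that r by (intro mult_strict_right_mono) auto
    finally show ?thesis .
  qed
  ultimately have "k = r"
    by linarith
  then show "2 * card E = t * a * (k * (k - 1))"
    using size by simp
qed

lemma half_plus_sqrt_iff:
  fixes x k :: real
  assumes "x \<ge> 0" and "k \<ge> 1"
  shows half_plus_sqrt_le_iff: "1 / 2 + sqrt (1 / 4 + x) \<le> k \<longleftrightarrow> x \<le> k * (k - 1)"
    and half_plus_sqrt_eq_iff: "k = 1 / 2 + sqrt (1 / 4 + x) \<longleftrightarrow> x = k * (k - 1)"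
proof -
  have root: "sqrt ((k - 1 / 2)\<^sup>2) = k - 1 / 2"
    using assms(2) by simp
  have square: "(k - 1 / 2)\<^sup>2 = 1 / 4 + k * (k - 1)"
    by (simp add: power2_eq_square algebra_simps)
  have "1 / 2 + sqrt (1 / 4 + x) \<le> k \<longleftrightarrow> sqrt (1 / 4 + x) \<le> sqrt ((k - 1 / 2)\<^sup>2)"
    unfolding root by linarith
  then show "1 / 2 + sqrt (1 / 4 + x) \<le> k \<longleftrightarrow> x \<le> k * (k - 1)"
    unfolding square by simp
  have "k = 1 / 2 + sqrt (1 / 4 + x) \<longleftrightarrow> sqrt (1 / 4 + x) = sqrt ((k - 1 / 2)\<^sup>2)"
    unfolding root by linarith
  then show "k = 1 / 2 + sqrt (1 / 4 + x) \<longleftrightarrow> x = k * (k - 1)"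
    unfolding square by simp
qed

theorem theorem3p1:
  fixes V :: "'a set" and E :: "'a set set" and t m :: nat
  assumes "simple_graph V E"
    and "V \<noteq> {}"
    and "t \<ge> 1"
    and "m = card E"
  shows "real (frugal_chromatic_number t V E)
           \<ge> 1 / 2 + sqrt (1 / 4 + 2 * real m / (real t * real (frugal_independence_number t V E)))
    \<and> (m > 0 \<longrightarrow>
        (real (frugal_chromatic_number t V E)
           = 1 / 2 + sqrt (1 / 4 + 2 * real m / (real t * real (frugal_independence_number t V E)))
         \<longleftrightarrow> (V, E) \<in> Psi t))"
proof -
  interpret simple_graph V E
    by fact
  define k where "k = frugal_chromatic_number t V E"
  define a where "a = frugal_independence_number t V E"
  define x where "x = 2 * real m / (real t * real a)"
  have "k \<ge> 1"
    using frugal_chromatic_number_pos[OF assms(2,3)] by (simp add: k_def)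
  then have k: "real k \<ge> 1" "real (k * (k - 1)) = real k * (real k - 1)"
    by (auto simp: of_nat_diff)
  have "x \<ge> 0"
    by (simp add: x_def)
  have pos: "real t * real a > 0"
    using frugal_independence_number_pos[OF assms(2,3)] assms(3) by (simp add: a_def)
  have x_le: "x \<le> real k * (real k - 1) \<longleftrightarrow> 2 * m \<le> t * a * (k * (k - 1))"
  proof -
    have "x \<le> real (k * (k - 1)) \<longleftrightarrow> real (2 * m) \<le> real (t * a * (k * (k - 1)))"
      using pos by (simp add: x_def pos_divide_le_eq mult.commute)
    then show ?thesis
      by (simp only: k(2) of_nat_le_iff)
  qed
  have x_eq: "x = real k * (real k - 1) \<longleftrightarrow> 2 * m = t * a * (k * (k - 1))"
  proof -
    have "x = real (k * (k - 1)) \<longleftrightarrow> real (2 * m) = real (t * a * (k * (k - 1)))"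
      using pos unfolding x_def by (subst divide_eq_eq) (auto simp: mult.commute)
    then show ?thesis
      by (simp only: k(2) of_nat_eq_iff)
  qed
  have "1 / 2 + sqrt (1 / 4 + x) \<le> real k"
    unfolding half_plus_sqrt_le_iff[OF \<open>x \<ge> 0\<close> k(1)] x_le
    unfolding k_def a_def assms(4) by (rule twice_size_le_frugal_numbers[OF assms(3)])
  moreover have "real k = 1 / 2 + sqrt (1 / 4 + x) \<longleftrightarrow> (V, E) \<in> Psi t" if "m > 0"
    unfolding half_plus_sqrt_eq_iff[OF \<open>x \<ge> 0\<close> k(1)] x_eq
    using that unfolding k_def a_def assms(4) by (rule twice_size_eq_iff_Psi[OF assms(2,3)])
  ultimately show ?thesis
    by (simp add: k_def a_def x_def)
qed

end
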